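(* Let $H$ be a graph and let $G=H\vee K_1$ be the cone over $H$ (the graph obtained from $H$ by adding one new vertex adjacent to all vertices of $H$), and suppose $G$ has $n$ vertices. Let $\rho$ be the spectral radius of the adjacency matrix of $G$, $\rho_H$ the spectral radius of the adjacency matrix of $H$, $v$ the positive Perron eigenvector of $G$ normalized by $\|v\|_2=1$, and $S=\|v\|_1$. Then $$S^2\ge\frac{(\rho+1)^2(\rho-\rho_H)^2}{(\rho-\rho_H)^2+n-1}.$$ *)

theory Defs
  imports
    "Graph_Theory.Pair_Digraph"
    "Jordan_Normal_Form.Spectral_Radius"
begin

text \<open>
  A finite simple graph is a \<open>pair_graph\<close>: a finite vertex set \<open>pverts\<close> together with an
  irreflexive, symmetric set \<open>parcs\<close> of ordered pairs of vertices, both orientations of an edge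
  being present.
\<close>

text \<open>The cone \<open>H \<or> K\<^sub>1\<close>. The new vertex is \<open>None\<close>; a vertex \<open>u\<close> of \<open>H\<close> becomes \<open>Some u\<close>.\<close>

definition cone :: "'a pair_pre_digraph \<Rightarrow> 'a option pair_pre_digraph" where
  "cone H = \<lparr> pverts = insert None (Some ` pverts H),
              parcs = {(Some x, Some y) | x y. (x, y) \<in> parcs H}
                    \<union> {(None, Some x) | x. x \<in> pverts H}
                    \<union> {(Some x, None) | x. x \<in> pverts H} \<rparr>"

text \<open>
  Rows and columns of a \<open>mat\<close> are indexed by natural numbers, so the adjacency matrix is taken
  with respect to an enumeration \<open>us\<close> of the vertices, meant to satisfy \<open>distinct us\<close> and
  \<open>set us = pverts G\<close>.
\<close>

definition adjacency_matrix :: "'a list \<Rightarrow> 'a pair_pre_digraph \<Rightarrow> real mat" where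
  "adjacency_matrix us G =
     mat (length us) (length us) (\<lambda>(i, j). if (us ! i, us ! j) \<in> parcs G then 1 else 0)"

definition l1_norm :: "real vec \<Rightarrow> real" where
  "l1_norm v = (\<Sum>i<dim_vec v. \<bar>v $ i\<bar>)"

definition l2_norm :: "real vec \<Rightarrow> real" where
  "l2_norm v = sqrt (\<Sum>i<dim_vec v. (v $ i)\<^sup>2)"

text \<open>\<open>spectral_radius\<close> is defined on complex matrices, hence the embedding.\<close>

definition real_spectral_radius :: "real mat \<Rightarrow> real" where
  "real_spectral_radius A = spectral_radius (map_mat complex_of_real A)"

end

theory Submission
  imports Defs "HOL-Analysis.L2_Norm"
begin

text \<open>
  Write \<open>c\<close> for the Perron weight of the apex and \<open>w\<close> for the restriction of \<open>v\<close> to \<open>H\<close>. The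
  eigenvalue equation at the apex gives \<open>S = (\<rho> + 1) c\<close>, and on \<open>H\<close> it reads
  \<open>\<rho> w - A\<^sub>H w = c 1\<close>. Since \<open>A\<^sub>H\<close> is symmetric, its operator norm is \<open>\<rho>\<^sub>H\<close>, so taking norms
  yields \<open>(\<rho> - \<rho>\<^sub>H) \<parallel>w\<parallel> \<le> c \<surd>(n - 1)\<close>. Here \<open>\<rho> \<ge> \<rho>\<^sub>H\<close> because \<open>A\<^sub>H w \<le> \<rho> w\<close> with \<open>w > 0\<close>.
  Substituting \<open>\<parallel>w\<parallel>\<^sup>2 = 1 - c\<^sup>2\<close> bounds \<open>c\<^sup>2\<close> from below.
\<close>

section \<open>Euclidean norm: triangle and Cauchy-Schwarz inequalities\<close>

lemma l2_norm_eq_L2_set: "l2_norm v = L2_set (($) v) {..<dim_vec v}"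
  by (simp add: l2_norm_def L2_set_def)

lemma l2_norm_nonneg: "0 \<le> l2_norm v"
  by (simp add: l2_norm_eq_L2_set)

lemma l2_norm_power2: "(l2_norm v)\<^sup>2 = v \<bullet> v"
  by (simp add: l2_norm_def scalar_prod_def sum_nonneg lessThan_atLeast0 power2_eq_square)

lemma l2_norm_smult: "l2_norm (a \<cdot>\<^sub>v v) = \<bar>a\<bar> * l2_norm v"
  by (simp add: l2_norm_def power_mult_distrib sum_distrib_left[symmetric] real_sqrt_mult)

lemma l2_norm_triangle:
  assumes "u \<in> carrier_vec n" "v \<in> carrier_vec n"
  shows "l2_norm (u + v) \<le> l2_norm u + l2_norm v"
proof -
  have "l2_norm (u + v) = L2_set (\<lambda>i. u $ i + v $ i) {..<n}"
    using assms unfolding l2_norm_eq_L2_set by (auto intro: L2_set_cong)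
  then show ?thesis
    using L2_set_triangle_ineq[of "($) u" "($) v" "{..<n}"] assms
    by (simp add: l2_norm_eq_L2_set)
qed

lemma scalar_prod_le_l2_norm:
  assumes "u \<in> carrier_vec n" "v \<in> carrier_vec n"
  shows "u \<bullet> v \<le> l2_norm u * l2_norm v"
proof -
  have "u \<bullet> v \<le> (\<Sum>i<n. \<bar>u $ i\<bar> * \<bar>v $ i\<bar>)"
    using assms unfolding scalar_prod_def lessThan_atLeast0
    by (auto intro!: sum_mono simp: abs_mult[symmetric])
  also have "\<dots> \<le> l2_norm u * l2_norm v"
    using L2_set_mult_ineq[of "($) u" "($) v" "{..<n}"] assms by (simp add: l2_norm_eq_L2_set)
  finally show ?thesis .
qed

lemma l2_norm_le_sum_abs: "l2_norm v \<le> (\<Sum>i<dim_vec v. \<bar>v $ i\<bar>)"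
  unfolding l2_norm_eq_L2_set by (rule L2_set_le_sum_abs)

section \<open>Operator norm of a symmetric matrix versus its spectral radius\<close>

text \<open>Symmetry moves one factor \<open>A\<close> across the inner product of
  \<open>A *\<^sub>v v\<close> with itself; Cauchy-Schwarz does the rest.\<close>

lemma symmetric_l2_norm_log_convex:
  assumes A: "A \<in> carrier_mat n n" and sym: "A\<^sup>T = A" and v: "v \<in> carrier_vec n"
  shows "(l2_norm (A *\<^sub>v v))\<^sup>2 \<le> l2_norm v * l2_norm (A *\<^sub>v (A *\<^sub>v v))"
proof -
  have "(l2_norm (A *\<^sub>v v))\<^sup>2 = v \<bullet> (A *\<^sub>v (A *\<^sub>v v))"
    using transpose_vec_mult_scalar[OF A v, of "A *\<^sub>v v"] A v
      comm_scalar_prod[of v n "A *\<^sub>v (A *\<^sub>v v)"]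
    by (simp add: l2_norm_power2 sym)
  also have "\<dots> \<le> l2_norm v * l2_norm (A *\<^sub>v (A *\<^sub>v v))"
    using A v by (intro scalar_prod_le_l2_norm[of _ n]) auto
  finally show ?thesis .
qed

text \<open>Log-convexity makes the successive ratios nondecreasing, so a first ratio
  \<open>q\<close> above 1 would force growth at least like \<open>q ^ k\<close>, against the bound
  \<open>K\<close>.\<close>

lemma log_convex_bounded_imp_decreasing:
  fixes a :: "nat \<Rightarrow> real"
  assumes nonneg: "\<And>k. 0 \<le> a k"
    and convex: "\<And>k. (a (Suc k))\<^sup>2 \<le> a k * a (Suc (Suc k))"
    and bounded: "\<And>k. a k \<le> K"
  shows "a 1 \<le> a 0"
proof (rule ccontr)
  assume "\<not> a 1 \<le> a 0"
  then have less: "a 0 < a 1" by simp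
  \<comment> \<open>If \<open>a 0\<close> were 0, convexity would force \<open>a 1 = 0\<close>,
    contradicting \<open>less\<close>.\<close>
  have pos0: "0 < a 0"
    using convex[of 0] nonneg[of 0] less by (cases "a 0 = 0") auto
  define q where "q = a 1 / a 0"
  have q: "1 < q" using less pos0 by (simp add: q_def)
  have step: "0 < a k \<and> q * a k \<le> a (Suc k)" for k
  proof (induction k)
    case 0
    then show ?case using pos0 by (simp add: q_def)
  next
    case (Suc k)
    then have "0 < q * a k" using q by simp
    with Suc have pos: "0 < a (Suc k)" by linarith
    have "a k * (q * a (Suc k)) = (q * a k) * a (Suc k)" by simp
    also have "\<dots> \<le> (a (Suc k))\<^sup>2"
      using Suc pos by (simp add: power2_eq_square mult_right_mono)
    also have "\<dots> \<le> a k * a (Suc (Suc k))" by (rule convex)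
    finally have "q * a (Suc k) \<le> a (Suc (Suc k))" using Suc by simp
    with pos show ?case by simp
  qed
  have growth: "q ^ k * a 0 \<le> a k" for k
  proof (induction k)
    case (Suc k)
    have "q ^ Suc k * a 0 = q * (q ^ k * a 0)" by simp
    also have "\<dots> \<le> q * a k" using Suc q by (intro mult_left_mono) auto
    also have "\<dots> \<le> a (Suc k)" using step by blast
    finally show ?case .
  qed simp
  obtain k where "K / a 0 < q ^ k" using real_arch_pow[OF q] by blast
  then have "K < q ^ k * a 0" using pos0 by (simp add: divide_simps)
  with growth[of k] bounded[of k] show False by linarith
qed

text \<open>Positive dimension makes the complex spectrum nonempty, so the maximum of the moduli is
  attained.\<close>

lemma real_spectral_radius_cases:
  assumes A: "A \<in> carrier_mat n n" and n: "0 < n"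
  obtains \<mu> where "eigenvalue (map_mat complex_of_real A) \<mu>" "norm \<mu> = real_spectral_radius A"
  using spectral_radius_mem_max(1)[of "map_mat complex_of_real A" n] A n
  unfolding spectrum_def real_spectral_radius_def by auto

lemma norm_eigenvalue_le_real_spectral_radius:
  assumes A: "A \<in> carrier_mat n n" and n: "0 < n"
    and \<mu>: "eigenvalue (map_mat complex_of_real A) \<mu>"
  shows "norm \<mu> \<le> real_spectral_radius A"
  using spectral_radius_mem_max(2)[of "map_mat complex_of_real A" n "norm \<mu>"] A n \<mu>
  unfolding spectrum_def real_spectral_radius_def by auto

text \<open>An eigenvector of \<open>c \<cdot>\<^sub>m A\<close> for \<open>\<mu>\<close> is one of
  \<open>A\<close> for \<open>\<mu> / c\<close>. This permits rescaling a matrix to spectral radius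
  below 1.\<close>

lemma real_spectral_radius_smult_le:
  assumes A: "A \<in> carrier_mat n n" and n: "0 < n" and c: "0 < c"
  shows "real_spectral_radius (c \<cdot>\<^sub>m A) \<le> c * real_spectral_radius A"
proof -
  let ?A = "map_mat complex_of_real A"
  have cA: "c \<cdot>\<^sub>m A \<in> carrier_mat n n" using A by simp
  obtain \<mu> where \<mu>: "eigenvalue (map_mat complex_of_real (c \<cdot>\<^sub>m A)) \<mu>"
    "norm \<mu> = real_spectral_radius (c \<cdot>\<^sub>m A)"
    using real_spectral_radius_cases[OF cA n] by blast
  have map: "map_mat complex_of_real (c \<cdot>\<^sub>m A) = complex_of_real c \<cdot>\<^sub>m ?A"
    by (intro eq_matI) auto
  obtain z where z: "z \<in> carrier_vec n" "z \<noteq> 0\<^sub>v n"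
    "(complex_of_real c \<cdot>\<^sub>m ?A) *\<^sub>v z = \<mu> \<cdot>\<^sub>v z"
    using \<mu>(1) A unfolding map eigenvalue_def eigenvector_def by auto
  have "?A *\<^sub>v z = (\<mu> / complex_of_real c) \<cdot>\<^sub>v z"
  proof (rule eq_vecI)
    fix i assume i: "i < dim_vec ((\<mu> / complex_of_real c) \<cdot>\<^sub>v z)"
    then have "complex_of_real c * (?A *\<^sub>v z) $ i = \<mu> * z $ i"
      using arg_cong[OF z(3), of "\<lambda>x. x $ i"] A z(1)
      by (simp add: scalar_prod_def sum_distrib_left mult.assoc)
    then show "(?A *\<^sub>v z) $ i = ((\<mu> / complex_of_real c) \<cdot>\<^sub>v z) $ i"
      using i c by (simp add: field_simps)
  qed (use A z in auto)
  then have "eigenvalue ?A (\<mu> / complex_of_real c)"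
    using z A unfolding eigenvalue_def eigenvector_def by auto
  from norm_eigenvalue_le_real_spectral_radius[OF A n this] show ?thesis
    using c \<mu>(2) by (simp add: norm_divide divide_simps mult.commute)
qed

text \<open>
  The powers of \<open>A\<close> are bounded by the Jordan normal form, and \<open>k \<mapsto> \<parallel>A\<^sup>k v\<parallel>\<close> is log-convex;
  this replaces an appeal to the spectral theorem.
\<close>

lemma symmetric_contraction:
  assumes A: "A \<in> carrier_mat n n" and sym: "A\<^sup>T = A" and v: "v \<in> carrier_vec n"
    and small: "real_spectral_radius A < 1"
  shows "l2_norm (A *\<^sub>v v) \<le> l2_norm v"
proof -
  define a where "a k = l2_norm ((A ^\<^sub>m k) *\<^sub>v v)" for k
  have pow: "A ^\<^sub>m k \<in> carrier_mat n n" for k using A by simp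
  \<comment> \<open>Matrix powers unfold with the new factor on the right; the iteration on
    \<open>v\<close> wants it on the left.\<close>
  have comm: "A ^\<^sub>m Suc k = A * A ^\<^sub>m k" for k
  proof (induction k)
    case (Suc k)
    have "A ^\<^sub>m Suc (Suc k) = (A * A ^\<^sub>m k) * A" using Suc by simp
    also have "\<dots> = A * A ^\<^sub>m Suc k" using A pow by (simp add: assoc_mult_mat[OF A pow A])
    finally show ?case .
  qed (use A in simp)
  have Suc_pow: "(A ^\<^sub>m Suc k) *\<^sub>v v = A *\<^sub>v ((A ^\<^sub>m k) *\<^sub>v v)" for k
    unfolding comm using assoc_mult_mat_vec[OF A pow v] .
  have hom: "map_mat complex_of_real (A ^\<^sub>m k) = (map_mat complex_of_real A) ^\<^sub>m k" for k
    using of_real_hom.mat_hom_pow[OF A] .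
  obtain c where c: "\<And>k. norm_bound ((map_mat complex_of_real A) ^\<^sub>m k) c"
    using spectral_radius_jnf_norm_bound_less_1_upper_triangular[of "map_mat complex_of_real A" n]
      A small unfolding real_spectral_radius_def by auto
  have entry: "\<bar>(A ^\<^sub>m k) $$ (i, j)\<bar> \<le> c" if "i < n" "j < n" for i j k
    using c[of k] that carrier_matD[OF pow[of k]]
    unfolding hom[symmetric] norm_bound_def by (simp del: pow_mat_dim)
  \<comment> \<open>The right-hand side is free of \<open>k\<close>, as the growth argument
    requires.\<close>
  have bounded: "a k \<le> (\<Sum>i<n. \<Sum>j<n. c * \<bar>v $ j\<bar>)" for k
  proof -
    have "a k \<le> (\<Sum>i<n. \<bar>((A ^\<^sub>m k) *\<^sub>v v) $ i\<bar>)"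
      using l2_norm_le_sum_abs[of "(A ^\<^sub>m k) *\<^sub>v v"] carrier_matD(1)[OF pow[of k]]
      by (simp add: a_def del: index_mult_mat_vec pow_mat_dim)
    also have "\<dots> \<le> (\<Sum>i<n. \<Sum>j<n. c * \<bar>v $ j\<bar>)"
    proof (rule sum_mono)
      fix i assume i: "i \<in> {..<n}"
      have "\<bar>((A ^\<^sub>m k) *\<^sub>v v) $ i\<bar> = \<bar>\<Sum>j<n. (A ^\<^sub>m k) $$ (i, j) * v $ j\<bar>"
        using i v carrier_matD[OF pow[of k]]
        by (simp add: scalar_prod_def lessThan_atLeast0 del: pow_mat_dim)
      also have "\<dots> \<le> (\<Sum>j<n. \<bar>(A ^\<^sub>m k) $$ (i, j) * v $ j\<bar>)" by (rule sum_abs)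
      also have "\<dots> \<le> (\<Sum>j<n. c * \<bar>v $ j\<bar>)"
        using i entry by (intro sum_mono) (auto simp: abs_mult intro: mult_right_mono)
      finally show "\<bar>((A ^\<^sub>m k) *\<^sub>v v) $ i\<bar> \<le> (\<Sum>j<n. c * \<bar>v $ j\<bar>)" .
    qed
    finally show ?thesis .
  qed
  have convex: "(a (Suc k))\<^sup>2 \<le> a k * a (Suc (Suc k))" for k
    unfolding a_def Suc_pow using pow[of k] v
    by (intro symmetric_l2_norm_log_convex[OF A sym]) auto
  have "a 1 \<le> a 0"
    by (rule log_convex_bounded_imp_decreasing[of a, OF _ convex bounded])
      (simp add: a_def l2_norm_nonneg)
  then show ?thesis using A v by (simp add: a_def)
qed

text \<open>For every \<open>r\<close> above the spectral radius, \<open>A\<close> divided by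
  \<open>r\<close> is a contraction; then \<open>r\<close> tends to the spectral radius.\<close>

lemma symmetric_l2_norm_mult_le:
  assumes A: "A \<in> carrier_mat n n" and sym: "A\<^sup>T = A" and v: "v \<in> carrier_vec n"
  shows "l2_norm (A *\<^sub>v v) \<le> real_spectral_radius A * l2_norm v"
proof (cases "n = 0")
  \<comment> \<open>The spectral radius of the empty matrix is \<open>Max {}\<close>, but both norms
    vanish.\<close>
  case True
  then show ?thesis using A v by (simp add: l2_norm_def)
next
  case False
  then have n: "0 < n" by simp
  obtain \<mu> :: complex where "norm \<mu> = real_spectral_radius A"
    using real_spectral_radius_cases[OF A n] by blast
  then have nonneg: "0 \<le> real_spectral_radius A" using norm_ge_zero[of \<mu>] by simp
  have scaled: "l2_norm (A *\<^sub>v v) \<le> r * l2_norm v" if r: "real_spectral_radius A < r" for r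
  proof -
    have r0: "0 < r" using nonneg r by simp
    have "real_spectral_radius ((1 / r) \<cdot>\<^sub>m A) \<le> (1 / r) * real_spectral_radius A"
      using r0 by (intro real_spectral_radius_smult_le[OF A n]) simp
    also have "\<dots> < 1" using r r0 by simp
    finally have "real_spectral_radius ((1 / r) \<cdot>\<^sub>m A) < 1" .
    moreover have "((1 / r) \<cdot>\<^sub>m A)\<^sup>T = (1 / r) \<cdot>\<^sub>m A"
      by (subst (2) sym[symmetric]) (rule eq_matI, auto)
    ultimately have "l2_norm (((1 / r) \<cdot>\<^sub>m A) *\<^sub>v v) \<le> l2_norm v"
      using A v by (intro symmetric_contraction[of _ n]) auto
    moreover have "((1 / r) \<cdot>\<^sub>m A) *\<^sub>v v = (1 / r) \<cdot>\<^sub>v (A *\<^sub>v v)"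
      using A v by (intro eq_vecI) auto
    ultimately show ?thesis using r0 by (simp add: l2_norm_smult divide_simps mult.commute)
  qed
  show ?thesis
  proof (rule field_le_epsilon)
    fix e :: real assume e: "0 < e"
    \<comment> \<open>The summand 1 keeps the denominator positive when \<open>v\<close> is
      zero.\<close>
    define d where "d = e / (l2_norm v + 1)"
    have d: "0 < d" "d * l2_norm v \<le> e"
      using e l2_norm_nonneg[of v] by (auto simp: d_def divide_simps algebra_simps)
    have "l2_norm (A *\<^sub>v v) \<le> (real_spectral_radius A + d) * l2_norm v"
      using d by (intro scaled) simp
    also have "\<dots> \<le> real_spectral_radius A * l2_norm v + e"
      using d by (simp add: algebra_simps)
    finally show "l2_norm (A *\<^sub>v v) \<le> real_spectral_radius A * l2_norm v + e" .
  qed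
qed

section \<open>Spectral radius of a nonnegative matrix from a positive test vector\<close>

text \<open>Let \<open>z\<close> be an eigenvector for an eigenvalue of maximal modulus and
  \<open>t\<close> the least factor with |z| \<le> t w entrywise. At an index \<open>i\<close> where
  equality holds, the triangle inequality in row \<open>i\<close> of the eigenvalue equation gives
  |\<mu>| t w_i \<le> t (A w)_i \<le> r t w_i.\<close>

lemma real_spectral_radius_le_subinvariant:
  assumes A: "A \<in> carrier_mat n n" and n: "0 < n"
    and nonneg: "\<And>i j. i < n \<Longrightarrow> j < n \<Longrightarrow> 0 \<le> A $$ (i, j)"
    and w: "w \<in> carrier_vec n" and pos: "\<And>i. i < n \<Longrightarrow> 0 < w $ i"
    and sub: "\<And>i. i < n \<Longrightarrow> (A *\<^sub>v w) $ i \<le> r * w $ i"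
  shows "real_spectral_radius A \<le> r"
proof -
  obtain \<mu> where \<mu>: "eigenvalue (map_mat complex_of_real A) \<mu>" "norm \<mu> = real_spectral_radius A"
    using real_spectral_radius_cases[OF A n] by blast
  obtain z where z: "z \<in> carrier_vec n" "z \<noteq> 0\<^sub>v n"
    "map_mat complex_of_real A *\<^sub>v z = \<mu> \<cdot>\<^sub>v z"
    using \<mu>(1) A unfolding eigenvalue_def eigenvector_def by auto
  define t where "t = Max ((\<lambda>i. norm (z $ i) / w $ i) ` {..<n})"
  have "t \<in> (\<lambda>i. norm (z $ i) / w $ i) ` {..<n}"
    unfolding t_def using n by (intro Max_in) auto
  then obtain i where i: "i < n" "t = norm (z $ i) / w $ i" by auto
  have le: "norm (z $ j) \<le> t * w $ j" if "j < n" for j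
  proof -
    have "norm (z $ j) / w $ j \<le> t" unfolding t_def using that by (intro Max_ge) auto
    then show ?thesis using pos[OF that] by (simp add: divide_simps)
  qed
  \<comment> \<open>A nonzero entry of \<open>z\<close> makes \<open>t\<close> positive, so the
    common factor can be cancelled at the end.\<close>
  obtain j where "j < n" "z $ j \<noteq> 0" using z by (metis carrier_vecD eq_vecI index_zero_vec)
  then have "0 < t * w $ j" using le[of j] by (meson less_le_trans zero_less_norm_iff)
  then have t: "0 < t" using pos[OF \<open>j < n\<close>] by (simp add: zero_less_mult_iff)
  have zi: "norm (z $ i) = t * w $ i" using i pos[of i] by simp
  have "norm \<mu> * norm (z $ i) = norm ((\<mu> \<cdot>\<^sub>v z) $ i)" using i z by (simp add: norm_mult)
  also have "\<dots> = norm (\<Sum>j<n. complex_of_real (A $$ (i, j)) * z $ j)"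
    unfolding z(3)[symmetric] using i z(1) A by (simp add: scalar_prod_def lessThan_atLeast0)
  also have "\<dots> \<le> (\<Sum>j<n. A $$ (i, j) * norm (z $ j))"
    using i nonneg by (intro sum_norm_le) (auto simp: norm_mult)
  also have "\<dots> \<le> (\<Sum>j<n. A $$ (i, j) * (t * w $ j))"
    using i nonneg le by (intro sum_mono mult_left_mono) auto
  also have "\<dots> = t * (A *\<^sub>v w) $ i"
    using i A w by (simp add: scalar_prod_def lessThan_atLeast0 sum_distrib_left mult_ac)
  also have "\<dots> \<le> t * (r * w $ i)" using sub i t by (intro mult_left_mono) auto
  also have "\<dots> = r * norm (z $ i)" using zi by simp
  finally show ?thesis using \<mu>(2) zi t pos[OF i(1)] by simp
qed

section \<open>Adjacency matrices as sums over neighbours\<close>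

lemma adjacency_matrix_carrier: "adjacency_matrix us G \<in> carrier_mat (length us) (length us)"
  by (simp add: adjacency_matrix_def)

lemma adjacency_matrix_symmetric:
  assumes "sym (parcs G)"
  shows "(adjacency_matrix us G)\<^sup>T = adjacency_matrix us G"
proof -
  have "(x, y) \<in> parcs G \<longleftrightarrow> (y, x) \<in> parcs G" for x y
    using assms by (auto dest: symD)
  then show ?thesis by (intro eq_matI) (auto simp: adjacency_matrix_def)
qed

lemma sum_nth_distinct:
  assumes "distinct us"
  shows "(\<Sum>i<length us. g (us ! i)) = sum g (set us)"
  using sum.reindex_bij_betw[OF bij_betw_nth[OF assms refl refl]] .

text \<open>Reading the vector as a function on vertices removes the enumeration from the eigenvalue
  equation.\<close>

lemma adjacency_matrix_mult_vec:
  assumes us: "distinct us" and i: "i < length us"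
  shows "(adjacency_matrix us G *\<^sub>v vec (length us) (\<lambda>i. f (us ! i))) $ i =
    (\<Sum>x\<in>set us. if (us ! i, x) \<in> parcs G then f x else 0)"
proof -
  have "(adjacency_matrix us G *\<^sub>v vec (length us) (\<lambda>i. f (us ! i))) $ i =
    (\<Sum>j<length us. if (us ! i, us ! j) \<in> parcs G then f (us ! j) else 0)"
    using i by (auto simp: adjacency_matrix_def scalar_prod_def lessThan_atLeast0 intro!: sum.cong)
  then show ?thesis using sum_nth_distinct[OF us] by simp
qed

section \<open>Apex and base components of the Perron vector of the cone\<close>

theorem theorem4p3:
  fixes H :: "'a pair_pre_digraph"
    and G :: "'a option pair_pre_digraph"
    and hs :: "'a list"
    and gs :: "'a option list"
    and n :: nat
    and \<rho> \<rho>\<^sub>H S :: real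
    and v :: "real vec"
  assumes H: "pair_graph H"
    and G: "G = cone H"
    and n: "n = card (pverts G)"
    and hs: "distinct hs" "set hs = pverts H"
    and gs: "distinct gs" "set gs = pverts G"
    and \<rho>: "\<rho> = real_spectral_radius (adjacency_matrix gs G)"
    and \<rho>\<^sub>H: "\<rho>\<^sub>H = real_spectral_radius (adjacency_matrix hs H)"
    and v_eigenvector: "eigenvector (adjacency_matrix gs G) v \<rho>"
    and v_positive: "\<And>i. i < n \<Longrightarrow> v $ i > 0"
    and v_normalized: "l2_norm v = 1"
    and S: "S = l1_norm v"
  shows "S\<^sup>2 \<ge> (\<rho> + 1)\<^sup>2 * (\<rho> - \<rho>\<^sub>H)\<^sup>2 / ((\<rho> - \<rho>\<^sub>H)\<^sup>2 + real n - 1)"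
proof -
  interpret pair_graph H by (rule H)
  have sym_parcs: "sym (parcs H)" by (auto intro: symI arcs_symmetric)
  define m where "m = length hs"
  define A where "A = adjacency_matrix hs H"
  have A: "A \<in> carrier_mat m m" by (simp add: A_def m_def adjacency_matrix_carrier)
  have vG: "pverts G = insert None (Some ` set hs)" by (simp add: G cone_def hs)
  have len: "length gs = n" using distinct_card[OF gs(1)] gs n by simp
  have nm: "n = Suc m"
    using distinct_card[OF hs(1)] by (simp add: n vG card_image m_def)
  have dim: "dim_vec v = n"
    using v_eigenvector by (simp add: eigenvector_def adjacency_matrix_def len)
  \<comment> \<open>\<open>f\<close> is \<open>v\<close> as a function on vertices:
    \<open>gs\<close> may list the apex at any position and the base in an order unrelated to
    \<open>hs\<close>.\<close>
  define f where "f u = v $ the_inv_into {..<n} ((!) gs) u" for u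
  have inj: "inj_on ((!) gs) {..<n}" using gs(1) len by (simp add: inj_on_nth)
  have f_nth: "f (gs ! i) = v $ i" if "i < n" for i
    using the_inv_into_f_f[OF inj, of i] that by (simp add: f_def)
  have v_eq: "v = vec (length gs) (\<lambda>i. f (gs ! i))"
    using dim len f_nth by (intro eq_vecI) auto
  have f_pos: "0 < f u" if u: "u \<in> pverts G" for u
  proof -
    obtain i where "i < n" "gs ! i = u"
      using u gs(2) len by (metis in_set_conv_nth)
    then show ?thesis using f_nth v_positive by metis
  qed
  define c where "c = f None"
  define w where "w = vec m (\<lambda>i. f (Some (hs ! i)))"
  have c: "0 < c" using f_pos vG by (simp add: c_def)
  have w: "w \<in> carrier_vec m" by (simp add: w_def)
  have w_pos: "0 < w $ i" if "i < m" for i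
    using that f_pos vG by (simp add: w_def m_def)
  have split: "sum g (set gs) = g None + (\<Sum>x\<in>set hs. g (Some x))" for g :: "_ \<Rightarrow> real"
    by (simp add: gs vG sum.reindex)
  \<comment> \<open>Used with the absolute value for \<open>S\<close> and with the square for the
    normalization.\<close>
  have split_v: "(\<Sum>i<n. g (v $ i)) = g c + (\<Sum>i<m. g (w $ i))" for g :: "real \<Rightarrow> real"
  proof -
    have "(\<Sum>i<n. g (v $ i)) = sum (\<lambda>u. g (f u)) (set gs)"
      using sum_nth_distinct[OF gs(1), of "\<lambda>u. g (f u)"] by (simp add: len f_nth)
    also have "\<dots> = g c + (\<Sum>i<m. g (w $ i))"
      using split[of "\<lambda>u. g (f u)"] sum_nth_distinct[OF hs(1), of "\<lambda>x. g (f (Some x))"]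
      by (simp add: c_def w_def m_def)
    finally show ?thesis .
  qed
  have eigen: "(\<Sum>u'\<in>set gs. if (u, u') \<in> parcs G then f u' else 0) = \<rho> * f u"
    if u: "u \<in> pverts G" for u
  proof -
    obtain i where i: "i < n" "gs ! i = u" using u gs(2) len by (metis in_set_conv_nth)
    have "adjacency_matrix gs G *\<^sub>v v = \<rho> \<cdot>\<^sub>v v"
      using v_eigenvector by (simp add: eigenvector_def)
    then have "(adjacency_matrix gs G *\<^sub>v v) $ i = \<rho> * v $ i" using i dim by simp
    then show ?thesis
      using adjacency_matrix_mult_vec[OF gs(1), of i G f] i len f_nth v_eq by metis
  qed
  have apex: "\<rho> * c = (\<Sum>x\<in>set hs. f (Some x))"
    using eigen[of None] unfolding split by (auto simp: vG c_def G cone_def hs)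
  \<comment> \<open>The summand \<open>c\<close> comes from the apex, a neighbour of every base
    vertex.\<close>
  have base: "(A *\<^sub>v w) $ i + c = \<rho> * w $ i" if i: "i < m" for i
  proof -
    have "\<rho> * f (Some (hs ! i)) =
        c + (\<Sum>x\<in>set hs. if (hs ! i, x) \<in> parcs H then f (Some x) else 0)"
      using eigen[of "Some (hs ! i)"] nth_mem[of i hs] i unfolding split
      by (simp add: vG c_def G cone_def m_def hs(2) image_iff cong: if_cong)
    then show ?thesis
      using adjacency_matrix_mult_vec[OF hs(1), of i H "\<lambda>x. f (Some x)"] i
      by (simp add: A_def w_def m_def)
  qed
  have S_eq: "S = (\<rho> + 1) * c"
  proof -
    have "S = c + (\<Sum>i<m. \<bar>w $ i\<bar>)"
      using split_v[of abs] c by (simp add: S l1_norm_def dim)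
    also have "(\<Sum>i<m. \<bar>w $ i\<bar>) = (\<Sum>i<m. w $ i)"
      using w_pos by (intro sum.cong) (auto intro: abs_of_pos)
    also have "(\<Sum>i<m. w $ i) = \<rho> * c"
      using apex sum_nth_distinct[OF hs(1), of "\<lambda>x. f (Some x)"] by (simp add: w_def m_def)
    finally show ?thesis by (simp add: algebra_simps)
  qed
  have norm_w: "(l2_norm w)\<^sup>2 = 1 - c\<^sup>2"
  proof -
    have "(l2_norm v)\<^sup>2 = c\<^sup>2 + (l2_norm w)\<^sup>2"
      using split_v[of "\<lambda>x. x\<^sup>2"] w by (simp add: l2_norm_def dim sum_nonneg)
    then show ?thesis using v_normalized by simp
  qed
  let ?\<delta> = "\<rho> - \<rho>\<^sub>H"
  have gap: "?\<delta>\<^sup>2 * (l2_norm w)\<^sup>2 \<le> c\<^sup>2 * real m"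
  proof (cases "m = 0")
    case True \<comment> \<open>here \<open>\<rho>\<^sub>H\<close> is the unspecified value \<open>Max {}\<close>\<close>
    then show ?thesis using w by (simp add: l2_norm_def)
  next
    case False
    \<comment> \<open>This makes the left side of the norm inequality nonnegative, so that the
      inequality may be squared.\<close>
    have "\<rho>\<^sub>H \<le> \<rho>"
      unfolding \<rho>\<^sub>H A_def[symmetric]
    proof (rule real_spectral_radius_le_subinvariant[OF A _ _ w w_pos])
      show "(A *\<^sub>v w) $ i \<le> \<rho> * w $ i" if "i < m" for i using base[OF that] c by simp
      show "0 \<le> A $$ (i, j)" if "i < m" "j < m" for i j
        using that by (simp add: A_def adjacency_matrix_def m_def)
    qed (use False in auto)
    moreover
    define u where "u = vec m (\<lambda>_. c)"
    have u: "u \<in> carrier_vec m" by (simp add: u_def)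
    have "(l2_norm u)\<^sup>2 = c\<^sup>2 * real m" by (simp add: l2_norm_def u_def sum_nonneg)
    moreover have "?\<delta> * l2_norm w \<le> l2_norm u"
    proof -
      have "A *\<^sub>v w + u = \<rho> \<cdot>\<^sub>v w"
        using base A w by (intro eq_vecI) (auto simp: u_def)
      \<comment> \<open>The norm of \<open>\<rho> \<cdot>\<^sub>v w\<close> yields |\<rho>|; the
        estimate \<rho> \<le> |\<rho>| then avoids deciding the sign of \<rho>.\<close>
      then have "\<bar>\<rho>\<bar> * l2_norm w \<le> l2_norm (A *\<^sub>v w) + l2_norm u"
        using l2_norm_triangle[of "A *\<^sub>v w" m u] A w u by (simp add: l2_norm_smult)
      moreover have "\<rho> * l2_norm w \<le> \<bar>\<rho>\<bar> * l2_norm w"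
        by (intro mult_right_mono) (auto simp: l2_norm_nonneg)
      moreover have "l2_norm (A *\<^sub>v w) \<le> \<rho>\<^sub>H * l2_norm w"
        using symmetric_l2_norm_mult_le[OF A _ w] adjacency_matrix_symmetric[OF sym_parcs]
        by (simp add: \<rho>\<^sub>H A_def)
      ultimately show ?thesis by (simp add: algebra_simps)
    qed
    ultimately show ?thesis
      using power_mono[of "?\<delta> * l2_norm w" "l2_norm u" 2] l2_norm_nonneg[of w]
      by (simp add: power_mult_distrib)
  qed
  have bound: "?\<delta>\<^sup>2 \<le> c\<^sup>2 * (?\<delta>\<^sup>2 + real m)"
    using gap norm_w by (simp add: algebra_simps)
  have "?\<delta>\<^sup>2 / (?\<delta>\<^sup>2 + real m) \<le> c\<^sup>2"
  \<comment> \<open>The denominator vanishes when \<open>m = 0\<close> and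
    \<open>\<rho> = \<rho>\<^sub>H\<close>; division by zero then gives 0, which is at most
    \<open>c\<^sup>2\<close>.\<close>
  proof (cases "?\<delta>\<^sup>2 + real m = 0")
    case False
    then have "0 < ?\<delta>\<^sup>2 + real m" by (simp add: order_less_le)
    then show ?thesis using bound by (simp add: pos_divide_le_eq)
  qed simp
  then have "(\<rho> + 1)\<^sup>2 * (?\<delta>\<^sup>2 / (?\<delta>\<^sup>2 + real m)) \<le> (\<rho> + 1)\<^sup>2 * c\<^sup>2"
    by (intro mult_left_mono) auto
  then show ?thesis by (simp add: S_eq nm power_mult_distrib)
qed

end
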